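(* Let $k\in[0,1)$ and let $S$ be a weakly regular AG-groupoid with left identity $e$. Then the following conditions are equivalent: (i) $S$ is regular. (ii) $f\wedge_k g\le f\circ_k g$ for every $(\in,\in\vee q_k)$-fuzzy quasi-ideal $f$ and every $(\in,\in\vee q_k)$-fuzzy left ideal $g$ of $S$. (iii) $f\wedge_k g\le f\circ_k g$ for every $(\in,\in\vee q_k)$-fuzzy bi-ideal $f$ and every $(\in,\in\vee q_k)$-fuzzy left ideal $g$ of $S$. (iv) $f\wedge_k g\le f\circ_k g$ for every $(\in,\in\vee q_k)$-fuzzy generalized bi-ideal $f$ and every $(\in,\in\vee q_k)$-fuzzy left ideal $g$ of $S$.
   Context: An AG-groupoid is a (non-empty) set $S$ with a binary operation satisfying $(ab)c=(cb)a$ for all $a,b,c\in S$. A left identity is an element $e$ with $ea=a$ for all $a$. $S$ is weakly regular if for each $a\in S$ there are $x,y\in S$ with $a=(ax)(ay)$; $S$ is regular if for each $a\in S$ there is $x\in S$ with $a=(ax)a$. A fuzzy subset of $S$ is a map $f:S\to[0,1]$; $\wedge$ denotes minimum, and $f\le g$ is meant pointwise. $1$ denotes the constant fuzzy subset with value $1$. The product is $(f\circ g)(a)=\sup_{a=bc}\, (f(b)\wedge g(c))$ (supremum over all $b,c\in S$ with $a=bc$), and $(f\circ g)(a)=0$ if $a$ is not a product of two elements. Further, $(f\wedge_k g)(a)=f(a)\wedge g(a)\wedge\frac{1-k}{2}$ and $(f\circ_k g)(a)=(f\circ g)(a)\wedge\frac{1-k}{2}$. For $x\in S$, $t\in(0,1]$: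 $x_t\in f$ means $f(x)\ge t$; $x_t q_k f$ means $f(x)+t+k>1$; $x_t\in\vee q_k f$ means $x_t\in f$ or $x_tq_kf$. A fuzzy subset $f$ is an $(\in,\in\vee q_k)$-fuzzy: - left ideal if $y_t\in f$ implies $(xy)_t\in\vee q_k f$ for all $x,y\in S$, $t\in(0,1]$; equivalently $f(xy)\ge f(y)\wedge\frac{1-k}{2}$ for all $x,y$; - subgroupoid if $x_t\in f$ and $y_r\in f$ imply $(xy)_{t\wedge r}\in\vee q_kf$; equivalently $f(xy)\ge f(x)\wedge f(y)\wedge\frac{1-k}{2}$ for all $x,y$; - generalized bi-ideal if $x_t\in f$ and $z_r\in f$ imply $((xy)z)_{t\wedge r}\in\vee q_kf$ for all $y$; equivalently $f((xy)z)\ge f(x)\wedge f(z)\wedge\frac{1-k}{2}$ for all $x,y,z$; - bi-ideal if it is both an $(\in,\in\vee q_k)$-fuzzy subgroupoid and an $(\in,\in\vee q_k)$-fuzzy generalized bi-ideal; - quasi-ideal if $f(x)\ge (f\circ 1)(x)\wedge(1\circ f)(x)\wedge\frac{1-k}{2}$ for all $x$. *)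

theory Defs
  imports Complex_Main
begin

text \<open>The underlying set \<open>S\<close> is the whole type \<open>'a\<close>, which is non-empty.\<close>

locale ag_groupoid =
  fixes mul :: "'a \<Rightarrow> 'a \<Rightarrow> 'a"
  assumes left_invertive: "mul (mul a b) c = mul (mul c b) a"

definition left_identity :: "('a \<Rightarrow> 'a \<Rightarrow> 'a) \<Rightarrow> 'a \<Rightarrow> bool" where
  "left_identity mul e \<longleftrightarrow> (\<forall>a. mul e a = a)"

definition weakly_regular :: "('a \<Rightarrow> 'a \<Rightarrow> 'a) \<Rightarrow> bool" where
  "weakly_regular mul \<longleftrightarrow> (\<forall>a. \<exists>x y. a = mul (mul a x) (mul a y))"

definition regular :: "('a \<Rightarrow> 'a \<Rightarrow> 'a) \<Rightarrow> bool" where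
  "regular mul \<longleftrightarrow> (\<forall>a. \<exists>x. a = mul (mul a x) a)"

definition fuzzy_subset :: "('a \<Rightarrow> real) \<Rightarrow> bool" where
  "fuzzy_subset f \<longleftrightarrow> (\<forall>x. f x \<in> {0..1})"

text \<open>For fuzzy subsets the supremum is over a set bounded by \<open>1\<close>; the empty case must be
  separated because \<open>Sup {}\<close> is unspecified on the reals.\<close>

definition fuzzy_prod ::
    "('a \<Rightarrow> 'a \<Rightarrow> 'a) \<Rightarrow> ('a \<Rightarrow> real) \<Rightarrow> ('a \<Rightarrow> real) \<Rightarrow> 'a \<Rightarrow> real" where
  "fuzzy_prod mul f g a =
     (if \<exists>b c. a = mul b c then Sup {min (f b) (g c) | b c. a = mul b c} else 0)"

definition fuzzy_meet_k ::
    "real \<Rightarrow> ('a \<Rightarrow> real) \<Rightarrow> ('a \<Rightarrow> real) \<Rightarrow> 'a \<Rightarrow> real" where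
  "fuzzy_meet_k k f g a = min (min (f a) (g a)) ((1 - k) / 2)"

definition fuzzy_prod_k ::
    "('a \<Rightarrow> 'a \<Rightarrow> 'a) \<Rightarrow> real \<Rightarrow> ('a \<Rightarrow> real) \<Rightarrow> ('a \<Rightarrow> real) \<Rightarrow> 'a \<Rightarrow> real" where
  "fuzzy_prod_k mul k f g a = min (fuzzy_prod mul f g a) ((1 - k) / 2)"

text \<open>\<open>pt_in f x t\<close>, \<open>pt_q k f x t\<close> and \<open>pt_in_or_q k f x t\<close> are the relations
  \<open>\<in>\<close>, \<open>q\<^sub>k\<close> and \<open>\<in>\<or>q\<^sub>k\<close> between the fuzzy point \<open>x\<^sub>t\<close> and \<open>f\<close>.\<close>

definition pt_in :: "('a \<Rightarrow> real) \<Rightarrow> 'a \<Rightarrow> real \<Rightarrow> bool" where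
  "pt_in f x t \<longleftrightarrow> f x \<ge> t"

definition pt_q :: "real \<Rightarrow> ('a \<Rightarrow> real) \<Rightarrow> 'a \<Rightarrow> real \<Rightarrow> bool" where
  "pt_q k f x t \<longleftrightarrow> f x + t + k > 1"

definition pt_in_or_q :: "real \<Rightarrow> ('a \<Rightarrow> real) \<Rightarrow> 'a \<Rightarrow> real \<Rightarrow> bool" where
  "pt_in_or_q k f x t \<longleftrightarrow> pt_in f x t \<or> pt_q k f x t"

definition fuzzy_left_ideal ::
    "('a \<Rightarrow> 'a \<Rightarrow> 'a) \<Rightarrow> real \<Rightarrow> ('a \<Rightarrow> real) \<Rightarrow> bool" where
  "fuzzy_left_ideal mul k f \<longleftrightarrow> fuzzy_subset f \<and>
     (\<forall>x y. \<forall>t\<in>{0<..1}. pt_in f y t \<longrightarrow> pt_in_or_q k f (mul x y) t)"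

definition fuzzy_subgroupoid ::
    "('a \<Rightarrow> 'a \<Rightarrow> 'a) \<Rightarrow> real \<Rightarrow> ('a \<Rightarrow> real) \<Rightarrow> bool" where
  "fuzzy_subgroupoid mul k f \<longleftrightarrow> fuzzy_subset f \<and>
     (\<forall>x y. \<forall>t\<in>{0<..1}. \<forall>r\<in>{0<..1}.
        pt_in f x t \<and> pt_in f y r \<longrightarrow> pt_in_or_q k f (mul x y) (min t r))"

definition fuzzy_generalized_bi_ideal ::
    "('a \<Rightarrow> 'a \<Rightarrow> 'a) \<Rightarrow> real \<Rightarrow> ('a \<Rightarrow> real) \<Rightarrow> bool" where
  "fuzzy_generalized_bi_ideal mul k f \<longleftrightarrow> fuzzy_subset f \<and>
     (\<forall>x y z. \<forall>t\<in>{0<..1}. \<forall>r\<in>{0<..1}.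
        pt_in f x t \<and> pt_in f z r \<longrightarrow> pt_in_or_q k f (mul (mul x y) z) (min t r))"

definition fuzzy_bi_ideal ::
    "('a \<Rightarrow> 'a \<Rightarrow> 'a) \<Rightarrow> real \<Rightarrow> ('a \<Rightarrow> real) \<Rightarrow> bool" where
  "fuzzy_bi_ideal mul k f \<longleftrightarrow>
     fuzzy_subgroupoid mul k f \<and> fuzzy_generalized_bi_ideal mul k f"

definition fuzzy_quasi_ideal ::
    "('a \<Rightarrow> 'a \<Rightarrow> 'a) \<Rightarrow> real \<Rightarrow> ('a \<Rightarrow> real) \<Rightarrow> bool" where
  "fuzzy_quasi_ideal mul k f \<longleftrightarrow> fuzzy_subset f \<and>
     (\<forall>x. f x \<ge> min (min (fuzzy_prod mul f (\<lambda>_. 1) x) (fuzzy_prod mul (\<lambda>_. 1) f x))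
                    ((1 - k) / 2))"

end

theory Submission
  imports Defs
begin

text \<open>
  With a left identity, weak regularity \<open>a = (ax)(ay)\<close> yields two factorizations: \<open>a = (aa)(xy)\<close>
  by the medial law, which unfolds to \<open>a \<in> (aS)a\<close>, and \<open>a = a((yx)a)\<close>. The first says that
  \<open>S\<close> is regular. In the second the left factor is \<open>a\<close> itself and the right factor lies in
  \<open>Sa\<close>, so it bounds \<open>f \<circ>\<^sub>k g\<close> from below by \<open>f \<and>\<^sub>k g\<close> for every fuzzy left ideal \<open>g\<close> and every
  fuzzy subset \<open>f\<close>. Hence all four conditions hold outright.
\<close>

context ag_groupoid
begin

text \<open>Three uses of the left invertive law:
  \<open>(ab)(cd) = ((cd)b)a = ((bd)c)a = (ac)(bd)\<close>.\<close>

lemma medial: "mul (mul a b) (mul c d) = mul (mul a c) (mul b d)"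
  by (metis left_invertive)

lemma left_identity_exchange:
  assumes "left_identity mul e"
  shows "mul a (mul b c) = mul b (mul a c)"
  using medial[of e a b c] assms by (simp add: left_identity_def)

lemma weakly_regular_imp_regular:
  assumes e: "left_identity mul e" and "weakly_regular mul"
  shows "regular mul"
  unfolding regular_def
proof
  fix a
  obtain x y where "a = mul (mul a x) (mul a y)"
    using assms(2) unfolding weakly_regular_def by blast
  then have a: "a = mul (mul a a) (mul x y)" by (metis medial)
  define w where "w = mul x y"
  \<comment> \<open>Since \<open>a = (aa)w = (wa)a\<close>, it remains to write \<open>wa\<close>
    with \<open>a\<close> as its left factor; expanding this \<open>a\<close> once more makes that
    possible.\<close>
  have "mul w a = mul w (mul (mul a a) w)" using a w_def by simp
  also have "\<dots> = mul (mul a a) (mul w w)" by (rule left_identity_exchange[OF e])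
  also have "\<dots> = mul (mul a w) (mul a w)" by (rule medial)
  also have "\<dots> = mul a (mul (mul a w) w)" by (rule left_identity_exchange[OF e])
  finally have wa: "mul w a = mul a (mul (mul a w) w)" .
  have "a = mul (mul w a) a" using a left_invertive[of a a w] w_def by simp
  then show "\<exists>z. a = mul (mul a z) a" using wa by metis
qed

lemma weakly_regular_factorization:
  assumes e: "left_identity mul e" and "weakly_regular mul"
  obtains u where "a = mul a (mul u a)"
proof -
  obtain x y where "a = mul (mul a x) (mul a y)"
    using assms(2) unfolding weakly_regular_def by blast
  also have "\<dots> = mul a (mul (mul a x) y)" by (rule left_identity_exchange[OF e])
  also have "\<dots> = mul a (mul (mul y x) a)" by (simp only: left_invertive[of a x y])
  finally show thesis by (rule that)
qed

end

text \<open>The fuzzy point condition is tested at the level \<open>t\<close> equal to the claimed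
  bound. If the \<open>pt_q\<close> alternative holds, then
  \<open>g (mul x y) > 1 - k - t \<ge> (1 - k) / 2 \<ge> t\<close>. Fuzzy points need
  \<open>t > 0\<close>, so \<open>t \<le> 0\<close> is a separate case.\<close>

lemma fuzzy_left_ideal_mul_ge:
  assumes "0 \<le> k" and g: "fuzzy_left_ideal mul k g"
  shows "min (g y) ((1 - k) / 2) \<le> g (mul x y)"
proof -
  define t where "t = min (g y) ((1 - k) / 2)"
  have bounds: "0 \<le> g (mul x y)" using g by (simp add: fuzzy_left_ideal_def fuzzy_subset_def)
  show ?thesis
  proof (cases "0 < t")
    case True
    have t: "t \<le> g y" "t \<le> (1 - k) / 2" unfolding t_def by (rule min.cobounded1, rule min.cobounded2)
    then have "t \<in> {0<..1}" using True \<open>0 \<le> k\<close> by simp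
    then have "pt_in_or_q k g (mul x y) t"
      using g t unfolding fuzzy_left_ideal_def pt_in_def by blast
    then show ?thesis
      using t by (auto simp: pt_in_or_q_def pt_in_def pt_q_def t_def[symmetric])
  next
    case False
    then show ?thesis using bounds t_def by linarith
  qed
qed

lemma fuzzy_prod_ge:
  assumes "fuzzy_subset f" and "a = mul b c"
  shows "min (f b) (g c) \<le> fuzzy_prod mul f g a"
proof -
  \<comment> \<open>On the reals, \<open>cSup_upper\<close> requires a bounded set;
    \<open>f \<le> 1\<close> bounds every minimum.\<close>
  have "f x \<le> 1" for x using assms(1) by (simp add: fuzzy_subset_def)
  then have "bdd_above {min (f b) (g c) | b c. a = mul b c}"
    by (auto intro!: bdd_aboveI[where M = 1] simp: min_le_iff_disj)
  then have "min (f b) (g c) \<le> Sup {min (f b) (g c) | b c. a = mul b c}"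
    using assms(2) by (intro cSup_upper) blast+
  then show ?thesis using assms(2) unfolding fuzzy_prod_def by auto
qed

text \<open>Passing from \<open>g a\<close> to \<open>g (mul u a)\<close> may lose everything above
  \<open>(1 - k) / 2\<close>; the cap on both sides absorbs this loss.\<close>

lemma (in ag_groupoid) fuzzy_meet_k_le_fuzzy_prod_k:
  assumes "0 \<le> k" and "left_identity mul e" and "weakly_regular mul"
    and f: "fuzzy_subset f" and g: "fuzzy_left_ideal mul k g"
  shows "fuzzy_meet_k k f g \<le> fuzzy_prod_k mul k f g"
proof (rule le_funI)
  fix a
  obtain u where "a = mul a (mul u a)"
    using assms(2,3) by (rule weakly_regular_factorization)
  then have "min (f a) (g (mul u a)) \<le> fuzzy_prod mul f g a"
    by (rule fuzzy_prod_ge[OF f])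
  then show "fuzzy_meet_k k f g a \<le> fuzzy_prod_k mul k f g a"
    using fuzzy_left_ideal_mul_ge[OF assms(1) g, of a u]
    unfolding fuzzy_meet_k_def fuzzy_prod_k_def by linarith
qed

theorem theorem19:
  fixes mul :: "'a \<Rightarrow> 'a \<Rightarrow> 'a" and e :: 'a and k :: real
  assumes "k \<in> {0..<1}"
    and "ag_groupoid mul"
    and "left_identity mul e"
    and "weakly_regular mul"
  shows
    "(regular mul \<longleftrightarrow>
        (\<forall>f g. fuzzy_quasi_ideal mul k f \<and> fuzzy_left_ideal mul k g \<longrightarrow>
           fuzzy_meet_k k f g \<le> fuzzy_prod_k mul k f g)) \<and>
     (regular mul \<longleftrightarrow>
        (\<forall>f g. fuzzy_bi_ideal mul k f \<and> fuzzy_left_ideal mul k g \<longrightarrow>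
           fuzzy_meet_k k f g \<le> fuzzy_prod_k mul k f g)) \<and>
     (regular mul \<longleftrightarrow>
        (\<forall>f g. fuzzy_generalized_bi_ideal mul k f \<and> fuzzy_left_ideal mul k g \<longrightarrow>
           fuzzy_meet_k k f g \<le> fuzzy_prod_k mul k f g))"
proof -
  have "regular mul"
    using assms(2-4) by (rule ag_groupoid.weakly_regular_imp_regular)
  \<comment> \<open>Each of the three kinds of ideal is in particular a fuzzy subset, so one
    inequality serves all of them.\<close>
  moreover have "fuzzy_meet_k k f g \<le> fuzzy_prod_k mul k f g"
    if "fuzzy_subset f" "fuzzy_left_ideal mul k g" for f g
    using ag_groupoid.fuzzy_meet_k_le_fuzzy_prod_k[OF assms(2) _ assms(3,4) that] assms(1) by simp
  ultimately show ?thesis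
    by (auto simp: fuzzy_quasi_ideal_def fuzzy_bi_ideal_def fuzzy_generalized_bi_ideal_def)
qed

end
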